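(* Let $\mathrm{BD}_{4n}$ ($n\ge 2$) be a binary dihedral group and let $G=\mathcal{C}(\mathrm{BD}_{4n},\Gamma)$ be a commuting graph on $\mathrm{BD}_{4n}$. Then $$G\cong\begin{cases}K_2 & \text{when }\Gamma=Z(\mathrm{BD}_{4n}),\\ nK_2 & \text{when }\Gamma=\Gamma_2,\\ K_{2n-2} & \text{when }\Gamma=\Gamma_3,\\ K_2\vee(nK_2\cup K_{2n-2}) & \text{when }\Gamma=\mathrm{BD}_{4n}.\end{cases}$$
   Context: The binary dihedral group of order $4n$ ($n\geq 2$) is $\mathrm{BD}_{4n}=\langle\alpha,\beta:\alpha^{2n}=\beta^4=1,\ \alpha^n=\beta^2,\ \alpha\beta=\beta\alpha^{-1}\rangle$, with center $Z(\mathrm{BD}_{4n})=\{e,\alpha^n\}$. Consider the subsets $$\Gamma_1=\{1,\alpha,\alpha^2,\ldots,\alpha^{2n-1}\},\quad \Gamma_2=\{\beta,\alpha\beta,\alpha^2\beta,\ldots,\alpha^{2n-1}\beta\},\quad \Gamma_3=\Gamma_1\setminus Z(\mathrm{BD}_{4n}).$$ For a group $H$ and a nonempty subset $\Gamma\subseteq H$, $\mathcal{C}(H,\Gamma)$ is the simple graph with node set $\Gamma$ in which two distinct elements are joined by an edge if and only if they commute in $H$. $K_m$ is the complete graph on $m$ nodes, $rK_m$ is the graph consisting of $r$ (disjoint) copies of $K_m$, $\cup$ denotes disjoint union of graphs, and the join $G_1\vee G_2$ is the graph with node set $V(G_1)\cup V(G_2)$ and edge set $E(G_1)\cup E(G_2)\cup\{y\sim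 z: y\in V(G_1),z\in V(G_2)\}$. *)

theory Defs
  imports "HOL-Algebra.Group" "Graph_Theory.Graph_Theory"
begin

section \<open>Group presentations\<close>

text \<open>A word is a list of letters over the type of generators: \<open>(x, True)\<close> stands for the
  generator \<open>x\<close> and \<open>(x, False)\<close> for its formal inverse. A relation \<open>u = v\<close> of a presentation is
  the pair \<open>(u, v)\<close>.\<close>

type_synonym 'g word = "('g \<times> bool) list"

inductive pres_eq :: "('g word \<times> 'g word) set \<Rightarrow> 'g word \<Rightarrow> 'g word \<Rightarrow> bool"
  for R :: "('g word \<times> 'g word) set" where
  rel: "(u, v) \<in> R \<Longrightarrow> pres_eq R u v"
| cancel: "pres_eq R [(x, s), (x, \<not> s)] []"
| refl: "pres_eq R u u"
| sym: "pres_eq R u v \<Longrightarrow> pres_eq R v u"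
| trans: "pres_eq R u v \<Longrightarrow> pres_eq R v w \<Longrightarrow> pres_eq R u w"
| append: "pres_eq R u u' \<Longrightarrow> pres_eq R v v' \<Longrightarrow> pres_eq R (u @ v) (u' @ v')"

definition pres_class :: "('g word \<times> 'g word) set \<Rightarrow> 'g word \<Rightarrow> 'g word set" where
  "pres_class R u = {v. pres_eq R u v}"

text \<open>The group presented by all elements of the type \<open>'g\<close> as generators, subject to the
  relations \<open>R\<close>: words modulo the least congruence that contains \<open>R\<close> and makes a generator and
  its formal inverse cancel.\<close>

definition presented_group :: "('g word \<times> 'g word) set \<Rightarrow> 'g word set monoid" where
  "presented_group R =
    \<lparr> carrier = range (pres_class R),
      monoid.mult = (\<lambda>X Y. \<Union>u\<in>X. \<Union>v\<in>Y. pres_class R (u @ v)),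
      one = pres_class R [] \<rparr>"

definition pres_gen :: "('g word \<times> 'g word) set \<Rightarrow> 'g \<Rightarrow> 'g word set" where
  "pres_gen R x = pres_class R [(x, True)]"

lemma pres_class_eq_iff: "pres_class R u = pres_class R v \<longleftrightarrow> pres_eq R u v"
proof
  assume "pres_class R u = pres_class R v"
  moreover have "v \<in> pres_class R v" by (simp add: pres_class_def pres_eq.refl)
  ultimately have "v \<in> pres_class R u" by simp
  then show "pres_eq R u v" by (simp add: pres_class_def)
next
  assume uv: "pres_eq R u v"
  have "pres_eq R u w \<longleftrightarrow> pres_eq R v w" for w
    using pres_eq.trans[OF uv, of w] pres_eq.trans[OF pres_eq.sym[OF uv], of w] by iprover
  then show "pres_class R u = pres_class R v" by (simp add: pres_class_def)
qed

lemma presented_group_mult: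
  "pres_class R u \<otimes>\<^bsub>presented_group R\<^esub> pres_class R v = pres_class R (u @ v)"
proof -
  have *: "pres_class R (u' @ v') = pres_class R (u @ v)"
    if u': "u' \<in> pres_class R u" and v': "v' \<in> pres_class R v" for u' v'
  proof -
    have "pres_eq R u u'" "pres_eq R v v'" using u' v' by (simp_all add: pres_class_def)
    then have "pres_eq R (u @ v) (u' @ v')" by (rule pres_eq.append)
    then show ?thesis using pres_eq.sym pres_class_eq_iff by metis
  qed
  have "(\<Union>u'\<in>pres_class R u. \<Union>v'\<in>pres_class R v. pres_class R (u' @ v')) =
      (\<Union>u'\<in>pres_class R u. \<Union>v'\<in>pres_class R v. pres_class R (u @ v))"
    by (intro SUP_cong HOL.refl *)
  moreover have "u \<in> pres_class R u" "v \<in> pres_class R v"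
    by (simp_all add: pres_class_def pres_eq.refl)
  then have "pres_class R u \<noteq> {}" "pres_class R v \<noteq> {}" by (metis empty_iff)+
  ultimately show ?thesis
    by (simp add: presented_group_def)
qed

lemma pres_eq_inverse:
  "pres_eq R (rev (map (\<lambda>(x, s). (x, \<not> s)) w) @ w) []"
proof (induction w)
  case Nil
  show ?case by (simp add: pres_eq.refl)
next
  case (Cons l w)
  obtain x s where l: "l = (x, s)" by force
  let ?i = "rev (map (\<lambda>(x, s). (x, \<not> s)) w)"
  have "pres_eq R [(x, \<not> s), (x, s)] []"
    using pres_eq.cancel[of R x "\<not> s"] by simp
  from pres_eq.append[OF pres_eq.refl[of R ?i] pres_eq.append[OF this pres_eq.refl[of R w]]]
  have "pres_eq R (?i @ (x, \<not> s) # (x, s) # w) (?i @ w)" by simp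
  from pres_eq.trans[OF this Cons.IH] show ?case by (simp add: l)
qed

lemma group_presented_group: "group (presented_group R)"
proof (rule groupI)
  fix X assume "X \<in> carrier (presented_group R)"
  then obtain u where u: "X = pres_class R u" by (auto simp: presented_group_def)
  show "\<one>\<^bsub>presented_group R\<^esub> \<otimes>\<^bsub>presented_group R\<^esub> X = X"
    using presented_group_mult[of R "[]" u] by (simp add: u presented_group_def)
  let ?i = "rev (map (\<lambda>(x, s). (x, \<not> s)) u)"
  have "pres_class R ?i \<otimes>\<^bsub>presented_group R\<^esub> X = \<one>\<^bsub>presented_group R\<^esub>"
    unfolding u presented_group_mult
    by (simp add: presented_group_def pres_class_eq_iff pres_eq_inverse)
  then show "\<exists>Y\<in>carrier (presented_group R).
      Y \<otimes>\<^bsub>presented_group R\<^esub> X = \<one>\<^bsub>presented_group R\<^esub>"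
    by (auto simp: presented_group_def)
next
  fix X Y assume "X \<in> carrier (presented_group R)" "Y \<in> carrier (presented_group R)"
  then obtain u v where "X = pres_class R u" "Y = pres_class R v"
    by (auto simp: presented_group_def)
  then show "X \<otimes>\<^bsub>presented_group R\<^esub> Y \<in> carrier (presented_group R)"
    by (simp add: presented_group_mult) (simp add: presented_group_def)
next
  fix X Y Z
  assume "X \<in> carrier (presented_group R)" "Y \<in> carrier (presented_group R)"
    "Z \<in> carrier (presented_group R)"
  then obtain u v w where "X = pres_class R u" "Y = pres_class R v" "Z = pres_class R w"
    by (auto simp: presented_group_def)
  then show "X \<otimes>\<^bsub>presented_group R\<^esub> Y \<otimes>\<^bsub>presented_group R\<^esub> Z =
      X \<otimes>\<^bsub>presented_group R\<^esub> (Y \<otimes>\<^bsub>presented_group R\<^esub> Z)"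
    by (simp add: presented_group_mult)
qed (simp add: presented_group_def)

section \<open>The binary dihedral group\<close>

datatype bd_generator = Alpha | Beta

definition bd_relations :: "nat \<Rightarrow> (bd_generator word \<times> bd_generator word) set" where
  "bd_relations n =
    {(replicate (2 * n) (Alpha, True), []),
     (replicate 4 (Beta, True), []),
     (replicate n (Alpha, True), replicate 2 (Beta, True)),
     ([(Alpha, True), (Beta, True)], [(Beta, True), (Alpha, False)])}"

text \<open>The index is \<open>n\<close>, so \<open>BD n\<close> is the group of order \<open>4 * n\<close> usually written with
  index \<open>4n\<close>.\<close>

definition BD :: "nat \<Rightarrow> bd_generator word set monoid" where
  "BD n = presented_group (bd_relations n)"

definition bd_alpha :: "nat \<Rightarrow> bd_generator word set" where
  "bd_alpha n = pres_gen (bd_relations n) Alpha"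

definition bd_beta :: "nat \<Rightarrow> bd_generator word set" where
  "bd_beta n = pres_gen (bd_relations n) Beta"

lemma group_BD: "group (BD n)"
  by (simp add: BD_def group_presented_group)

definition group_center :: "('a, 'b) monoid_scheme \<Rightarrow> 'a set" where
  "group_center H = {z \<in> carrier H. \<forall>x \<in> carrier H. z \<otimes>\<^bsub>H\<^esub> x = x \<otimes>\<^bsub>H\<^esub> z}"

definition Gamma1 :: "nat \<Rightarrow> bd_generator word set set" where
  "Gamma1 n = {bd_alpha n [^]\<^bsub>BD n\<^esub> i | i :: nat. i < 2 * n}"

definition Gamma2 :: "nat \<Rightarrow> bd_generator word set set" where
  "Gamma2 n = {bd_alpha n [^]\<^bsub>BD n\<^esub> i \<otimes>\<^bsub>BD n\<^esub> bd_beta n | i :: nat. i < 2 * n}"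

definition Gamma3 :: "nat \<Rightarrow> bd_generator word set set" where
  "Gamma3 n = Gamma1 n - group_center (BD n)"

section \<open>Graphs\<close>

text \<open>As in \<^theory>\<open>Graph_Theory.Digraph\<close>, a simple graph is a symmetric loop-free digraph without
  parallel arcs; an edge between \<open>x\<close> and \<open>y\<close> is the pair of arcs \<open>(x, y)\<close> and \<open>(y, x)\<close>.\<close>

definition commuting_graph :: "('a, 'b) monoid_scheme \<Rightarrow> 'a set \<Rightarrow> 'a pair_pre_digraph" where
  "commuting_graph H \<Gamma> =
    \<lparr> pverts = \<Gamma>,
      parcs = {(x, y). x \<in> \<Gamma> \<and> y \<in> \<Gamma> \<and> x \<noteq> y \<and> x \<otimes>\<^bsub>H\<^esub> y = y \<otimes>\<^bsub>H\<^esub> x} \<rparr>"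

definition complete_graph :: "nat \<Rightarrow> nat pair_pre_digraph" where
  "complete_graph m = \<lparr> pverts = {..<m}, parcs = {(i, j). i < m \<and> j < m \<and> i \<noteq> j} \<rparr>"

definition graph_copies :: "nat \<Rightarrow> 'a pair_pre_digraph \<Rightarrow> (nat \<times> 'a) pair_pre_digraph" where
  "graph_copies r G =
    \<lparr> pverts = {..<r} \<times> pverts G,
      parcs = {((i, u), (j, v)). i < r \<and> i = j \<and> (u, v) \<in> parcs G} \<rparr>"

definition graph_disjoint_union ::
  "'a pair_pre_digraph \<Rightarrow> 'b pair_pre_digraph \<Rightarrow> ('a + 'b) pair_pre_digraph" where
  "graph_disjoint_union G H =
    \<lparr> pverts = pverts G <+> pverts H,
      parcs = map_prod Inl Inl ` parcs G \<union> map_prod Inr Inr ` parcs H \<rparr>"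

text \<open>The two node sets are made disjoint by the sum type before they are joined.\<close>

definition graph_join ::
  "'a pair_pre_digraph \<Rightarrow> 'b pair_pre_digraph \<Rightarrow> ('a + 'b) pair_pre_digraph" where
  "graph_join G H =
    \<lparr> pverts = pverts G <+> pverts H,
      parcs = map_prod Inl Inl ` parcs G \<union> map_prod Inr Inr ` parcs H
        \<union> (Inl ` pverts G) \<times> (Inr ` pverts H) \<union> (Inr ` pverts H) \<times> (Inl ` pverts G) \<rparr>"

lemma pair_graph_iff:
  "pair_graph G \<longleftrightarrow> finite (pverts G) \<and> (\<forall>x y. (x, y) \<in> parcs G \<longrightarrow>
    x \<in> pverts G \<and> y \<in> pverts G \<and> x \<noteq> y \<and> (y, x) \<in> parcs G)" (is "?L \<longleftrightarrow> ?R")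
proof
  assume ?L
  then interpret pair_graph G .
  have "x \<in> pverts G \<and> y \<in> pverts G \<and> x \<noteq> y \<and> (y, x) \<in> parcs G" if "(x, y) \<in> parcs G" for x y
    using in_arcsD1[OF that] in_arcsD2[OF that] pair_no_loops[OF that] that pair_sym_arcs
    by (simp add: symmetric_def symD)
  then show ?R using pair_finite_verts by simp
next
  assume R: ?R
  have "parcs G \<subseteq> pverts G \<times> pverts G" using R by (simp add: subset_iff)
  then have "finite (parcs G)" using R by (simp add: finite_subset)
  moreover have "symmetric (with_proj G)" using R by (simp add: symmetric_def sym_def)
  ultimately show ?L
    using R by unfold_locales auto
qed

lemma pair_graph_commuting_graph:
  "finite \<Gamma> \<Longrightarrow> pair_graph (commuting_graph H \<Gamma>)"
  unfolding pair_graph_iff by (auto simp: commuting_graph_def)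

lemma pair_graph_complete_graph: "pair_graph (complete_graph m)"
  by (simp add: pair_graph_iff complete_graph_def)

lemma complete_digraph_complete_graph: "complete_digraph m (with_proj (complete_graph m))"
proof -
  interpret pair_graph "complete_graph m" by (rule pair_graph_complete_graph)
  have "graph (with_proj (complete_graph m))" by (rule graph_axioms)
  then show ?thesis by (auto simp: complete_digraph_def complete_graph_def)
qed

lemma pair_graph_graph_copies:
  "pair_graph G \<Longrightarrow> pair_graph (graph_copies r G)"
  unfolding pair_graph_iff by (simp add: graph_copies_def split_paired_all) blast

lemma map_prod_sum_iff:
  "(Inl u, Inl v) \<in> map_prod Inl Inl ` A \<longleftrightarrow> (u, v) \<in> A"
  "(Inr u', Inr v') \<in> map_prod Inr Inr ` B \<longleftrightarrow> (u', v') \<in> B"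
  "(Inr u', y) \<notin> map_prod Inl Inl ` A" "(x, Inr v') \<notin> map_prod Inl Inl ` A"
  "(Inl u, y') \<notin> map_prod Inr Inr ` B" "(x', Inl v) \<notin> map_prod Inr Inr ` B"
  by (auto intro: rev_image_eqI)

lemma pair_graph_graph_disjoint_union:
  "pair_graph G \<Longrightarrow> pair_graph H \<Longrightarrow> pair_graph (graph_disjoint_union G H)"
  unfolding pair_graph_iff
  by (simp add: graph_disjoint_union_def split_sum_all map_prod_sum_iff InlI InrI)

lemma pair_graph_graph_join:
  "pair_graph G \<Longrightarrow> pair_graph H \<Longrightarrow> pair_graph (graph_join G H)"
  unfolding pair_graph_iff
  by (simp add: graph_join_def split_sum_all map_prod_sum_iff InlI InrI)
    (auto simp: map_prod_sum_iff)

text \<open>For graphs given by pairs, \<^const>\<open>digraph_iso\<close> is the existence of an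
  adjacency-preserving bijection between the node sets.\<close>

lemma digraph_iso_pair_iff:
  assumes "pair_wf_digraph G" "pair_wf_digraph H"
  shows "digraph_iso (with_proj G) (with_proj H) \<longleftrightarrow>
    (\<exists>f. bij_betw f (pverts G) (pverts H) \<and>
      (\<forall>x\<in>pverts G. \<forall>y\<in>pverts G. (x, y) \<in> parcs G \<longleftrightarrow> (f x, f y) \<in> parcs H))"
    (is "?L \<longleftrightarrow> ?R")
proof
  interpret G: pair_wf_digraph G by fact
  interpret H: pair_wf_digraph H by fact
  {
    assume ?L
    then obtain h where h: "pre_digraph.digraph_isomorphism (with_proj G) h"
      and H: "with_proj H = app_iso h (with_proj G)"
      unfolding digraph_iso_def by blast
    let ?f = "iso_verts h"
    have inj: "inj_on ?f (pverts G)"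
      using h by (simp add: pre_digraph.digraph_isomorphism_def)
    have v: "pverts H = ?f ` pverts G" and a: "parcs H = iso_arcs h ` parcs G"
      and t: "iso_tail h = fst" and hd: "iso_head h = snd"
      using H by (simp_all add: with_proj_def app_iso_def)
    have e: "iso_arcs h e = (?f (fst e), ?f (snd e))" if "e \<in> parcs G" for e
      using h that t hd by (auto simp: pre_digraph.digraph_isomorphism_def prod_eq_iff)
    have "(x, y) \<in> parcs G \<longleftrightarrow> (?f x, ?f y) \<in> parcs H"
      if xy: "x \<in> pverts G" "y \<in> pverts G" for x y
    proof
      assume "(x, y) \<in> parcs G"
      then show "(?f x, ?f y) \<in> parcs H" using e a by force
    next
      assume "(?f x, ?f y) \<in> parcs H"
      then obtain p where p: "p \<in> parcs G" "(?f x, ?f y) = iso_arcs h p" using a by auto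
      then have "?f x = ?f (fst p)" "?f y = ?f (snd p)" using e by auto
      then have "x = fst p" "y = snd p"
        using inj xy p(1) G.arc_fst_in_verts G.arc_snd_in_verts by (auto dest: inj_onD)
      then show "(x, y) \<in> parcs G" using p by simp
    qed
    then show ?R using inj v by (auto simp: bij_betw_def)
  }
  {
    assume ?R
    then obtain f where bij: "bij_betw f (pverts G) (pverts H)"
      and adj: "\<And>x y. x \<in> pverts G \<Longrightarrow> y \<in> pverts G \<Longrightarrow>
        (x, y) \<in> parcs G \<longleftrightarrow> (f x, f y) \<in> parcs H" by blast
    let ?h = "\<lparr> iso_verts = f, iso_arcs = map_prod f f, iso_head = snd, iso_tail = fst \<rparr>"
    have inj: "inj_on f (pverts G)" and im: "f ` pverts G = pverts H"
      using bij by (auto simp: bij_betw_def)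
    have "inj_on (map_prod f f) (parcs G)"
      by (rule inj_on_subset[OF map_prod_inj_on[OF inj inj]])
        (auto dest: G.in_arcsD1 G.in_arcsD2)
    then have "pre_digraph.digraph_isomorphism (with_proj G) ?h"
      using inj G.wf_digraph by (simp add: pre_digraph.digraph_isomorphism_def)
    moreover have "parcs H = map_prod f f ` parcs G"
    proof (intro equalityI subsetI)
      fix p assume p: "p \<in> parcs H"
      then have "fst p \<in> f ` pverts G" "snd p \<in> f ` pverts G"
        unfolding im using H.arc_fst_in_verts H.arc_snd_in_verts by auto
      then obtain x y where xy: "x \<in> pverts G" "y \<in> pverts G" "p = (f x, f y)"
        by (auto simp: prod_eq_iff)
      then have "(x, y) \<in> parcs G" using adj p by simp
      then show "p \<in> map_prod f f ` parcs G" using xy by force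
    next
      fix p assume "p \<in> map_prod f f ` parcs G"
      then show "p \<in> parcs H" using adj by (auto dest: G.in_arcsD1 G.in_arcsD2)
    qed
    ultimately show ?L
      unfolding digraph_iso_def using im
      by (intro exI[of _ ?h]) (simp add: with_proj_def app_iso_def)
  }
qed

end

theory Submission
  imports Defs
begin

text \<open>Every element of the group is \<open>\<alpha>\<^sup>i \<beta>\<^sup>c\<close> with \<open>i\<close> taken modulo \<open>2n\<close> and \<open>c \<in> {0, 1}\<close>. These
  normal forms are pairwise distinct because their multiplication rule is associative and
  compatible with the relations, so that evaluating words by it is well defined on the group.
  Powers of \<open>\<alpha>\<close> commute with each other, \<open>\<alpha>\<^sup>i\<close> commutes with \<open>\<alpha>\<^sup>j \<beta>\<close> iff \<open>n\<close> divides \<open>i\<close>, and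
  \<open>\<alpha>\<^sup>i \<beta>\<close> commutes with \<open>\<alpha>\<^sup>j \<beta>\<close> iff \<open>n\<close> divides \<open>i - j\<close>. Hence \<open>1\<close> and \<open>\<alpha>\<^sup>n\<close> are joined to everything,
  the other powers of \<open>\<alpha>\<close> form a clique, and each \<open>\<alpha>\<^sup>i \<beta>\<close> is matched with \<open>\<alpha>\<^sup>i\<^sup>+\<^sup>n \<beta>\<close>.\<close>

section \<open>Normal forms and the evaluation of words\<close>

text \<open>The pair \<open>(i, c)\<close> stands for \<open>\<alpha>\<^sup>i \<beta>\<^sup>c\<close>; the rule comes from \<open>\<beta> \<alpha>\<^sup>j = \<alpha>\<^sup>-\<^sup>j \<beta>\<close> and \<open>\<beta>\<^sup>2 = \<alpha>\<^sup>n\<close>.\<close>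

fun nf_mult :: "nat \<Rightarrow> int \<times> bool \<Rightarrow> int \<times> bool \<Rightarrow> int \<times> bool" where
  "nf_mult n (i, c) (j, d) =
    ((i + (if c then - j else j) + (if c \<and> d then int n else 0)) mod (2 * int n), c \<noteq> d)"

text \<open>Once the inner reductions modulo 2n are dropped, both sides agree up to rearrangement,
  except when all three factors contain \<beta>: there one side gains n and the other loses n, which
  is the same modulo 2n.\<close>

lemma nf_mult_assoc: "nf_mult n (nf_mult n p q) r = nf_mult n p (nf_mult n q r)"
proof -
  obtain i c j d k e where "p = (i, c)" "q = (j, d)" "r = (k, e)"
    by (metis surj_pair)
  have mods: "(x mod m + y + z) mod m = (x + y + z) mod m"
    "(x + y mod m + z) mod m = (x + y + z) mod m"
    "(x + - (y mod m) + z) mod m = (x + - y + z) mod m" for x y z m :: int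
    by (simp_all add: mod_eq_dvd_iff) (simp_all flip: minus_mult_div_eq_mod)
  show ?thesis
    by (cases c; cases d; cases e) (simp_all only: \<open>p = _\<close> \<open>q = _\<close> \<open>r = _\<close> nf_mult.simps
      if_True if_False simp_thms mods prod.inject, simp_all add: mod_eq_dvd_iff)
qed

text \<open>The inverse of \<beta> is \<alpha>^n \<beta>, because \<alpha>^n \<beta> \<beta> =
  \<alpha>^(2n) = 1. The exponent -1 is left unreduced here; \<open>nf_word\<close> reduces it by
  multiplying.\<close>

fun nf_letter :: "nat \<Rightarrow> bd_generator \<times> bool \<Rightarrow> int \<times> bool" where
  "nf_letter n (Alpha, s) = (if s then 1 else - 1, False)"
| "nf_letter n (Beta, s) = (if s then 0 else int n, True)"

fun nf_word :: "nat \<Rightarrow> bd_generator word \<Rightarrow> int \<times> bool" where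
  "nf_word n [] = (0, False)"
| "nf_word n (l # w) = nf_mult n (nf_letter n l) (nf_word n w)"

text \<open>Multiplying by \<open>(0, False)\<close> reduces the exponent modulo 2n, so the identity
  law is stated for values of \<open>nf_word\<close>, which are already reduced.\<close>

lemma nf_mult_one: "nf_mult n (0, False) (nf_word n w) = nf_word n w"
proof (cases w)
  case (Cons l v)
  then show ?thesis
    by (cases "nf_letter n l"; cases "nf_word n v") simp
qed simp

lemma nf_word_append: "nf_word n (u @ v) = nf_mult n (nf_word n u) (nf_word n v)"
  by (induction u) (simp_all add: nf_mult_one nf_mult_assoc)

lemma nf_word_alphas: "nf_word n (replicate k (Alpha, True)) = (int k mod (2 * int n), False)"
  by (induction k) (simp_all add: mod_simps)

lemma nf_word_relation:
  assumes "(u, v) \<in> bd_relations n"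
  shows "nf_word n u = nf_word n v"
  using assms unfolding bd_relations_def
  by (auto simp: nf_word_alphas, auto simp: numeral_eq_Suc mod_simps)

text \<open>Induction over the congruence; the \<open>append\<close> rule is covered by
  multiplicativity of \<open>nf_word\<close>. This invariant keeps the presented group from
  collapsing: words with different normal forms lie in different classes.\<close>

lemma nf_word_pres_eq: "pres_eq (bd_relations n) u v \<Longrightarrow> nf_word n u = nf_word n v"
proof (induction rule: pres_eq.induct)
  case (cancel x s)
  show ?case by (cases x; cases s) (simp_all add: mod_simps)
qed (simp_all add: nf_word_relation nf_word_append)

section \<open>Computation with the generators in the presented group\<close>

lemma (in group) conj_inverts_int_pow:
  assumes a: "a \<in> carrier G" and b: "b \<in> carrier G" and rel: "a \<otimes> b = b \<otimes> inv a"
  shows "b \<otimes> a [^] (i :: int) = a [^] (- i) \<otimes> b"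
proof -
  have pos: "b \<otimes> inv (a [^] k) = a [^] k \<otimes> b" for k :: nat
  proof (induction k)
    case 0
    show ?case using b by simp
  next
    case (Suc k)
    have "b \<otimes> inv (a [^] Suc k) = b \<otimes> inv a \<otimes> inv (a [^] k)"
      using a b by (simp add: inv_mult_group m_assoc)
    also have "\<dots> = a \<otimes> (b \<otimes> inv (a [^] k))"
      using a b by (simp add: rel[symmetric] m_assoc)
    also have "\<dots> = a [^] Suc k \<otimes> b"
      using a b by (simp only: Suc nat_pow_Suc2[OF a]) (simp add: m_assoc)
    finally show ?case .
  qed
  have neg: "b \<otimes> a [^] k = inv (a [^] k) \<otimes> b" for k :: nat
  proof -
    \<comment> \<open>Reading \<open>pos\<close> backwards turns a^k b into b a^(-k), which cancels
      the a^k on the right.\<close>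
    have "a [^] k \<otimes> (b \<otimes> a [^] k) = b"
      using a b by (simp add: m_assoc[symmetric] pos[symmetric]) (simp add: m_assoc)
    then show ?thesis using a b by (metis inv_solve_left m_closed nat_pow_closed)
  qed
  show ?thesis
    using pos neg a by (cases i rule: int_cases2) (simp_all add: int_pow_neg int_pow_int)
qed

definition bd_elem :: "nat \<Rightarrow> int \<times> bool \<Rightarrow> bd_generator word set" where
  "bd_elem n p = bd_alpha n [^]\<^bsub>BD n\<^esub> fst p \<otimes>\<^bsub>BD n\<^esub> (if snd p then bd_beta n else \<one>\<^bsub>BD n\<^esub>)"

lemma pres_class_carrier: "pres_class (bd_relations n) u \<in> carrier (BD n)"
  by (simp add: BD_def presented_group_def)

lemma pres_class_Nil: "pres_class (bd_relations n) [] = \<one>\<^bsub>BD n\<^esub>"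
  by (simp add: BD_def presented_group_def)

lemma pres_class_append:
  "pres_class (bd_relations n) (u @ v) =
    pres_class (bd_relations n) u \<otimes>\<^bsub>BD n\<^esub> pres_class (bd_relations n) v"
  by (simp add: BD_def presented_group_mult)

lemma pres_class_relation:
  "(u, v) \<in> bd_relations n \<Longrightarrow> pres_class (bd_relations n) u = pres_class (bd_relations n) v"
  by (simp add: pres_class_eq_iff pres_eq.rel)

lemma pres_class_replicate:
  "pres_class (bd_relations n) (replicate k l) = pres_class (bd_relations n) [l] [^]\<^bsub>BD n\<^esub> k"
proof -
  interpret group "BD n" by (rule group_BD)
  show ?thesis
  proof (induction k)
    case (Suc k)
    have "replicate (Suc k) l = replicate k l @ [l]" by (simp add: replicate_append_same)
    then show ?case using Suc by (simp only: pres_class_append nat_pow_Suc)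
  qed (simp add: pres_class_Nil)
qed

lemma pres_class_inv_letter:
  "pres_class (bd_relations n) [(x, False)] = inv\<^bsub>BD n\<^esub> pres_class (bd_relations n) [(x, True)]"
proof -
  interpret group "BD n" by (rule group_BD)
  have "pres_class (bd_relations n) [(x, False), (x, True)] = \<one>\<^bsub>BD n\<^esub>"
    using pres_eq.cancel[of "bd_relations n" x False]
    by (simp add: pres_class_eq_iff flip: pres_class_Nil)
  then have "pres_class (bd_relations n) [(x, False)] \<otimes>\<^bsub>BD n\<^esub>
      pres_class (bd_relations n) [(x, True)] = \<one>\<^bsub>BD n\<^esub>"
    by (simp flip: pres_class_append)
  then show ?thesis by (simp add: inv_equality pres_class_carrier)
qed

lemma bd_alpha_carrier: "bd_alpha n \<in> carrier (BD n)"
  and bd_beta_carrier: "bd_beta n \<in> carrier (BD n)"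
  by (simp_all add: bd_alpha_def bd_beta_def pres_gen_def pres_class_carrier)

lemma bd_alpha_order: "bd_alpha n [^]\<^bsub>BD n\<^esub> (2 * n) = \<one>\<^bsub>BD n\<^esub>"
  unfolding bd_alpha_def pres_gen_def pres_class_replicate[symmetric] pres_class_Nil[symmetric]
  by (rule pres_class_relation) (simp add: bd_relations_def)

lemma bd_alpha_pow_eq: "bd_alpha n [^]\<^bsub>BD n\<^esub> n = bd_beta n \<otimes>\<^bsub>BD n\<^esub> bd_beta n"
proof -
  interpret group "BD n" by (rule group_BD)
  have "bd_alpha n [^]\<^bsub>BD n\<^esub> n = bd_beta n [^]\<^bsub>BD n\<^esub> (2 :: nat)"
    unfolding bd_alpha_def bd_beta_def pres_gen_def pres_class_replicate[symmetric]
    by (rule pres_class_relation) (simp add: bd_relations_def)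
  then show ?thesis by (simp add: numeral_2_eq_2 bd_beta_carrier)
qed

lemma bd_alpha_beta: "bd_alpha n \<otimes>\<^bsub>BD n\<^esub> bd_beta n = bd_beta n \<otimes>\<^bsub>BD n\<^esub> inv\<^bsub>BD n\<^esub> bd_alpha n"
  unfolding bd_alpha_def bd_beta_def pres_gen_def pres_class_inv_letter[symmetric]
    pres_class_append[symmetric]
  by (rule pres_class_relation) (simp add: bd_relations_def)

text \<open>Since \<alpha>^(2n) = 1, the reduction built into \<open>nf_mult\<close> is invisible in
  the group.\<close>

lemma bd_alpha_int_pow_mod:
  "bd_alpha n [^]\<^bsub>BD n\<^esub> (i mod (2 * int n)) = bd_alpha n [^]\<^bsub>BD n\<^esub> i"
proof -
  interpret group "BD n" by (rule group_BD)
  have ord: "bd_alpha n [^]\<^bsub>BD n\<^esub> (2 * int n) = \<one>\<^bsub>BD n\<^esub>"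
    using bd_alpha_order[of n] int_pow_int[of "BD n" "bd_alpha n" "2 * n"] by simp
  then have period: "bd_alpha n [^]\<^bsub>BD n\<^esub> (2 * int n * k) = \<one>\<^bsub>BD n\<^esub>" for k
    unfolding int_pow_pow[OF bd_alpha_carrier, symmetric] by (simp only: int_pow_one)
  have "bd_alpha n [^]\<^bsub>BD n\<^esub> i =
      bd_alpha n [^]\<^bsub>BD n\<^esub> (2 * int n * (i div (2 * int n)) + i mod (2 * int n))" by simp
  also have "\<dots> = bd_alpha n [^]\<^bsub>BD n\<^esub> (i mod (2 * int n))"
    unfolding int_pow_mult[OF bd_alpha_carrier] period using bd_alpha_carrier by simp
  finally show ?thesis by simp
qed

lemma bd_elem_carrier: "bd_elem n p \<in> carrier (BD n)"
proof -
  interpret group "BD n" by (rule group_BD)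
  show ?thesis by (simp add: bd_elem_def bd_alpha_carrier bd_beta_carrier)
qed

text \<open>The formula of \<open>nf_mult\<close> is what the relations force: moving \<beta> past
  \<alpha>^j inverts the power, and \<beta> \<beta> becomes \<alpha>^n.\<close>

lemma bd_elem_mult: "bd_elem n p \<otimes>\<^bsub>BD n\<^esub> bd_elem n q = bd_elem n (nf_mult n p q)"
proof -
  interpret group "BD n" by (rule group_BD)
  let ?a = "bd_alpha n" and ?b = "bd_beta n"
  note carrier = bd_alpha_carrier[of n] bd_beta_carrier[of n]
  note swap = conj_inverts_int_pow[OF carrier bd_alpha_beta]
  obtain i c j d where [simp]: "p = (i, c)" "q = (j, d)" by (metis surj_pair)
  have bb: "?b \<otimes>\<^bsub>BD n\<^esub> ?b = ?a [^]\<^bsub>BD n\<^esub> int n"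
    by (simp add: bd_alpha_pow_eq int_pow_int)
  have aba: "?a [^]\<^bsub>BD n\<^esub> i \<otimes>\<^bsub>BD n\<^esub> ?b \<otimes>\<^bsub>BD n\<^esub> ?a [^]\<^bsub>BD n\<^esub> j =
      ?a [^]\<^bsub>BD n\<^esub> (i - j) \<otimes>\<^bsub>BD n\<^esub> ?b"
    using carrier
    by (simp add: m_assoc swap) (simp add: m_assoc[symmetric] int_pow_mult[symmetric])
  have "?a [^]\<^bsub>BD n\<^esub> i \<otimes>\<^bsub>BD n\<^esub> ?b \<otimes>\<^bsub>BD n\<^esub> (?a [^]\<^bsub>BD n\<^esub> j \<otimes>\<^bsub>BD n\<^esub> ?b) =
      ?a [^]\<^bsub>BD n\<^esub> (i - j) \<otimes>\<^bsub>BD n\<^esub> (?b \<otimes>\<^bsub>BD n\<^esub> ?b)"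
    using carrier aba by (metis int_pow_closed m_assoc m_closed)
  also have "\<dots> = ?a [^]\<^bsub>BD n\<^esub> (i - j + int n)"
    using carrier by (simp only: bb int_pow_mult)
  finally have abab: "?a [^]\<^bsub>BD n\<^esub> i \<otimes>\<^bsub>BD n\<^esub> ?b \<otimes>\<^bsub>BD n\<^esub> (?a [^]\<^bsub>BD n\<^esub> j \<otimes>\<^bsub>BD n\<^esub> ?b) =
      ?a [^]\<^bsub>BD n\<^esub> (i - j + int n)" .
  show ?thesis
    using carrier aba abab
    by (cases c; cases d)
      (simp_all add: bd_elem_def bd_alpha_int_pow_mod int_pow_mult m_assoc[symmetric])
qed

lemma bd_elem_letter: "bd_elem n (nf_letter n l) = pres_class (bd_relations n) [l]"
proof -
  interpret group "BD n" by (rule group_BD)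
  note carrier = bd_alpha_carrier[of n] bd_beta_carrier[of n]
  \<comment> \<open>This is the case of the formal inverse of \<beta>: the element \<alpha>^n
    \<beta> is checked to be a left inverse.\<close>
  have "bd_alpha n [^]\<^bsub>BD n\<^esub> int n \<otimes>\<^bsub>BD n\<^esub> bd_beta n \<otimes>\<^bsub>BD n\<^esub> bd_beta n =
      bd_alpha n [^]\<^bsub>BD n\<^esub> n \<otimes>\<^bsub>BD n\<^esub> bd_alpha n [^]\<^bsub>BD n\<^esub> n"
    using carrier by (simp add: m_assoc bd_alpha_pow_eq int_pow_int)
  also have "\<dots> = \<one>\<^bsub>BD n\<^esub>"
    using carrier bd_alpha_order[of n] by (simp add: nat_pow_mult mult_2)
  finally have "inv\<^bsub>BD n\<^esub> bd_beta n = bd_alpha n [^]\<^bsub>BD n\<^esub> int n \<otimes>\<^bsub>BD n\<^esub> bd_beta n"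
    using carrier by (simp add: inv_equality)
  then show ?thesis
    using carrier
    by (cases "(n, l)" rule: nf_letter.cases)
      (auto simp: bd_elem_def int_pow_neg pres_class_inv_letter
        simp flip: pres_gen_def bd_alpha_def bd_beta_def)
qed

text \<open>Converse of \<open>nf_word_pres_eq\<close>: words with the same normal form lie in the
  same class, as the class can be recovered from the normal form.\<close>

lemma bd_elem_nf_word: "bd_elem n (nf_word n w) = pres_class (bd_relations n) w"
proof -
  interpret group "BD n" by (rule group_BD)
  show ?thesis
  proof (induction w)
    case Nil
    show ?case by (simp add: bd_elem_def pres_class_Nil)
  next
    case (Cons l w)
    then show ?case
      using pres_class_append[of n "[l]" w] by (simp flip: bd_elem_mult bd_elem_letter)
  qed
qed

section \<open>Bijection between normal forms and group elements\<close>

abbreviation nf_carrier :: "nat \<Rightarrow> (int \<times> bool) set" where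
  "nf_carrier n \<equiv> {0..<2 * int n} \<times> UNIV"

lemma nf_word_range:
  assumes "n > 0"
  shows "range (nf_word n) = nf_carrier n"
proof (intro equalityI subsetI)
  fix p assume "p \<in> range (nf_word n)"
  then obtain w where p: "p = nf_word n w" by auto
  obtain i c where ic: "nf_word n w = (i, c)" by force
  \<comment> \<open>A left factor \<open>(0, False)\<close> only reduces modulo 2n, and
    \<open>nf_mult_one\<close> says that it changes nothing.\<close>
  then have "i mod (2 * int n) = i" using nf_mult_one[of n w] by simp
  then show "p \<in> nf_carrier n"
    using assms pos_mod_bound[of "2 * int n" i] pos_mod_sign[of "2 * int n" i] by (simp add: p ic)
next
  fix p assume "p \<in> nf_carrier n"
  then obtain i c where ic: "p = (i, c)" "0 \<le> i" "i < 2 * int n" by auto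
  have "nf_word n (replicate (nat i) (Alpha, True) @ (if c then [(Beta, True)] else [])) = p"
    using ic by (auto simp: nf_word_append nf_word_alphas)
  then show "p \<in> range (nf_word n)" by (metis rangeI)
qed

text \<open>Both halves are read off from words: equal images of two normal forms make the
  underlying words congruent, hence the normal forms equal; and every class is the image of the
  normal form of any word in it.\<close>

lemma bij_betw_bd_elem:
  assumes "n > 0"
  shows "bij_betw (bd_elem n) (nf_carrier n) (carrier (BD n))"
proof -
  have "inj_on (bd_elem n) (range (nf_word n))"
    by (intro inj_onI) (elim rangeE, simp add: bd_elem_nf_word pres_class_eq_iff nf_word_pres_eq)
  moreover have "bd_elem n ` range (nf_word n) = carrier (BD n)"
    by (simp add: image_comp comp_def bd_elem_nf_word BD_def presented_group_def)
  ultimately show ?thesis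
    using nf_word_range[OF assms] by (simp add: bij_betw_def)
qed

section \<open>Commutation as divisibility\<close>

text \<open>The pairs may be unreduced: both products land in \<open>nf_carrier\<close>, where
  \<open>bd_elem\<close> is injective.\<close>

lemma bd_elem_commute_iff:
  assumes "n > 0"
  shows "bd_elem n p \<otimes>\<^bsub>BD n\<^esub> bd_elem n q = bd_elem n q \<otimes>\<^bsub>BD n\<^esub> bd_elem n p \<longleftrightarrow>
    nf_mult n p q = nf_mult n q p"
proof -
  have "nf_mult n p q \<in> nf_carrier n" for p q
    using assms by (cases p; cases q) simp
  then show ?thesis
    using inj_on_eq_iff[OF bij_betw_imp_inj_on[OF bij_betw_bd_elem[OF assms]]]
    by (simp only: bd_elem_mult)
qed

fun nf_commute :: "nat \<Rightarrow> int \<times> bool \<Rightarrow> int \<times> bool \<Rightarrow> bool" where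
  "nf_commute n (i, False) (j, False) \<longleftrightarrow> True"
| "nf_commute n (i, False) (j, True) \<longleftrightarrow> int n dvd i"
| "nf_commute n (i, True) (j, False) \<longleftrightarrow> int n dvd j"
| "nf_commute n (i, True) (j, True) \<longleftrightarrow> int n dvd i - j"

text \<open>Unless both factors are powers of \<alpha>, the exponents of the two products differ, up
  to sign, by 2i, 2j or 2(i - j), and 2n divides 2m iff n divides m.\<close>

lemma nf_mult_commute_iff: "nf_mult n p q = nf_mult n q p \<longleftrightarrow> nf_commute n p q"
proof -
  have double: "2 * int n dvd k \<longleftrightarrow> int n dvd m" if "k = 2 * m \<or> k = 2 * (- m)" for k m
    using that by (auto simp del: mult_minus_right)
  show ?thesis
    by (cases "(n, p, q)" rule: nf_commute.cases)
      (simp_all add: mod_eq_dvd_iff add.commute double)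
qed

lemma int_dvd_lt_double_iff:
  assumes "0 \<le> i" "i < 2 * int n"
  shows "int n dvd i \<longleftrightarrow> i = 0 \<or> i = int n"
proof
  assume "int n dvd i"
  then obtain k where k: "i = int n * k" by auto
  have "0 < int n" using assms by linarith
  with assms have "0 \<le> k" "k < 2"
    using mult_less_cancel_left_pos[of "int n" k 2]
      \<open>0 < int n\<close> by (simp_all add: k zero_le_mult_iff mult.commute[of 2])
  then have "k = 0 \<or> k = 1" by linarith
  then show "i = 0 \<or> i = int n" using k by auto
qed auto

section \<open>Graph isomorphisms from labellings of the nodes\<close>

text \<open>The labelling goes from the model graph to \<Gamma>, where explicit formulas are
  available; its inverse is the isomorphism. Only distinct nodes have to be compared, as neither
  graph has loops.\<close>

lemma digraph_iso_commuting_graphI: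
  assumes "finite \<Gamma>" "pair_graph H" and bij: "bij_betw f (pverts H) \<Gamma>"
    and adj: "\<And>x y. x \<in> pverts H \<Longrightarrow> y \<in> pverts H \<Longrightarrow> x \<noteq> y \<Longrightarrow>
      (x, y) \<in> parcs H \<longleftrightarrow> f x \<otimes>\<^bsub>G\<^esub> f y = f y \<otimes>\<^bsub>G\<^esub> f x"
  shows "digraph_iso (with_proj (commuting_graph G \<Gamma>)) (with_proj H)"
proof -
  interpret C: pair_graph "commuting_graph G \<Gamma>"
    using assms(1) by (rule pair_graph_commuting_graph)
  interpret H: pair_graph H by fact
  note wf = C.pair_wf_digraph_axioms H.pair_wf_digraph_axioms
  let ?g = "inv_into (pverts H) f"
  have g: "bij_betw ?g \<Gamma> (pverts H)" using bij by (rule bij_betw_inv_into)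
  have "(x, y) \<in> parcs (commuting_graph G \<Gamma>) \<longleftrightarrow> (?g x, ?g y) \<in> parcs H"
    if "x \<in> \<Gamma>" "y \<in> \<Gamma>" for x y
  proof (cases "x = y")
    case True
    then show ?thesis using assms(2) by (auto simp: commuting_graph_def pair_graph_iff)
  next
    case False
    have "?g x \<in> pverts H" "?g y \<in> pverts H" "f (?g x) = x" "f (?g y) = y"
      using that g bij by (auto dest: bij_betwE simp: bij_betw_inv_into_right)
    moreover from this have "?g x \<noteq> ?g y" using False by metis
    ultimately show ?thesis
      using adj[of "?g x" "?g y"] False that by (auto simp: commuting_graph_def)
  qed
  then show ?thesis
    unfolding digraph_iso_pair_iff[OF wf] using g
    by (intro exI[of _ ?g]) (simp add: commuting_graph_def)
qed

text \<open>Composing a labelling by normal forms with \<open>bd_elem\<close> turns each isomorphism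
  into a question about divisibility of exponents.\<close>

lemma digraph_iso_commuting_graph_BD:
  assumes "n > 0" "pair_graph H" "S \<subseteq> nf_carrier n" and bij: "bij_betw f (pverts H) S"
    and adj: "\<And>x y. x \<in> pverts H \<Longrightarrow> y \<in> pverts H \<Longrightarrow> x \<noteq> y \<Longrightarrow>
      (x, y) \<in> parcs H \<longleftrightarrow> nf_commute n (f x) (f y)"
  shows "digraph_iso (with_proj (commuting_graph (BD n) (bd_elem n ` S))) (with_proj H)"
proof (rule digraph_iso_commuting_graphI)
  have "bij_betw (bd_elem n) S (bd_elem n ` S)"
    using bij_betw_bd_elem[OF assms(1)] assms(3) by (rule bij_betw_subset) simp
  then show "bij_betw (bd_elem n \<circ> f) (pverts H) (bd_elem n ` S)"
    using bij by (rule bij_betw_trans[rotated])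
  show "finite (bd_elem n ` S)"
    by (rule finite_imageI[OF finite_subset[OF assms(3)]]) simp
  show "(x, y) \<in> parcs H \<longleftrightarrow> (bd_elem n \<circ> f) x \<otimes>\<^bsub>BD n\<^esub> (bd_elem n \<circ> f) y =
      (bd_elem n \<circ> f) y \<otimes>\<^bsub>BD n\<^esub> (bd_elem n \<circ> f) x"
    if "x \<in> pverts H" "y \<in> pverts H" "x \<noteq> y" for x y
    unfolding comp_apply bd_elem_commute_iff[OF assms(1)] nf_mult_commute_iff
    using that by (rule adj)
qed (fact assms(2))

section \<open>The center and the subsets in terms of normal forms\<close>

lemma group_center_BD:
  assumes "n \<ge> 2"
  shows "group_center (BD n) = bd_elem n ` {(0, False), (int n, False)}"
proof -
  have pos: "n > 0" using assms by simp
  have im: "carrier (BD n) = bd_elem n ` nf_carrier n"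
    using bij_betw_bd_elem[OF pos] by (simp add: bij_betw_def)
  have "(\<forall>q\<in>nf_carrier n. nf_commute n p q) \<longleftrightarrow> p \<in> {(0, False), (int n, False)}"
    if "p \<in> nf_carrier n" for p
  proof (cases p)
    case (Pair i c)
    have i: "0 \<le> i" "i < 2 * int n" using that Pair by auto
    show ?thesis
    proof (cases c)
      case True
      \<comment> \<open>No \<alpha>^i \<beta> is central: commuting with \<alpha> would require n to
        divide 1, which fails as \<open>n \<ge> 2\<close>.\<close>
      have "(1, False) \<in> nf_carrier n" using pos by simp
      moreover have "\<not> nf_commute n p (1, False)" using True Pair assms by simp
      ultimately have "\<not> (\<forall>q\<in>nf_carrier n. nf_commute n p q)" by blast
      then show ?thesis using True Pair by auto
    next
      case False
      \<comment> \<open>A power of \<alpha> is central as soon as it commutes with \<beta>.\<close>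
      have "nf_commute n (i, False) q \<longleftrightarrow> \<not> snd q \<or> int n dvd i" for q
        by (cases q; cases "snd q") simp_all
      moreover have "(0, True) \<in> nf_carrier n" using pos by simp
      ultimately have "(\<forall>q\<in>nf_carrier n. nf_commute n p q) \<longleftrightarrow> int n dvd i"
        using False Pair by (metis snd_conv)
      then show ?thesis using False Pair int_dvd_lt_double_iff[OF i] by simp
    qed
  qed
  then have "{p \<in> nf_carrier n. \<forall>q\<in>nf_carrier n. nf_commute n p q} =
      nf_carrier n \<inter> {(0, False), (int n, False)}"
    by blast
  also have "\<dots> = {(0, False), (int n, False)}" using pos by auto
  finally have central: "{p \<in> nf_carrier n. \<forall>q\<in>nf_carrier n. nf_commute n p q} =
      {(0, False), (int n, False)}" .
  have "group_center (BD n) =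
      bd_elem n ` {p \<in> nf_carrier n. \<forall>q\<in>nf_carrier n. nf_commute n p q}"
    unfolding group_center_def im Compr_image_eq ball_simps bd_elem_commute_iff[OF pos]
      nf_mult_commute_iff ..
  then show ?thesis unfolding central .
qed

lemma image_lessThan_eq_atLeastLessThan_int: "int ` {..<m} = {0..<int m}"
  by (metis atLeast0LessThan image_int_atLeastLessThan of_nat_0)

lemma Gamma1_eq: "Gamma1 n = bd_elem n ` ({0..<2 * int n} \<times> {False})"
proof -
  interpret group "BD n" by (rule group_BD)
  have "bd_alpha n [^]\<^bsub>BD n\<^esub> i = bd_elem n (int i, False)" for i
    by (simp add: bd_elem_def int_pow_int bd_alpha_carrier)
  then have "Gamma1 n = (\<lambda>i. bd_elem n (i, False)) ` int ` {..<2 * n}"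
    by (auto simp: Gamma1_def)
  then show ?thesis
    unfolding image_lessThan_eq_atLeastLessThan_int by auto
qed

lemma Gamma2_eq: "Gamma2 n = bd_elem n ` ({0..<2 * int n} \<times> {True})"
proof -
  have "bd_alpha n [^]\<^bsub>BD n\<^esub> i \<otimes>\<^bsub>BD n\<^esub> bd_beta n = bd_elem n (int i, True)" for i
    by (simp add: bd_elem_def int_pow_int)
  then have "Gamma2 n = (\<lambda>i. bd_elem n (i, True)) ` int ` {..<2 * n}"
    by (auto simp: Gamma2_def)
  then show ?thesis
    unfolding image_lessThan_eq_atLeastLessThan_int by auto
qed

text \<open>Injectivity of \<open>bd_elem\<close> on normal forms allows the center to be removed at
  the level of exponents.\<close>

lemma Gamma3_eq:
  assumes "n \<ge> 2"
  shows "Gamma3 n = bd_elem n ` (({0..<2 * int n} - {0, int n}) \<times> {False})"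
proof -
  have "inj_on (bd_elem n) (nf_carrier n)"
    using bij_betw_bd_elem assms by (simp add: bij_betw_def)
  then have "Gamma3 n =
      bd_elem n ` ({0..<2 * int n} \<times> {False} - {(0, False), (int n, False)})"
    unfolding Gamma3_def Gamma1_eq group_center_BD[OF assms]
    by (rule inj_on_image_set_diff[symmetric]) (use assms in auto)
  then show ?thesis by (auto intro!: arg_cong[where f = "image _"])
qed

section \<open>Labellings of the complete graphs and of the copies of K_2\<close>

definition center_index :: "nat \<Rightarrow> nat \<Rightarrow> int \<times> bool" where
  "center_index n k = (int (k * n), False)"

text \<open>The number of the copy of K_2 is the residue of the exponent modulo n; the two ends of
  an edge differ by the factor \<alpha>^n.\<close>

definition beta_index :: "nat \<Rightarrow> nat \<times> nat \<Rightarrow> int \<times> bool" where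
  "beta_index n p = (int (fst p + snd p * n), True)"

text \<open>Enumerates the exponents 1, ..., n - 1, n + 1, ..., 2n - 1, skipping the central
  exponents 0 and n.\<close>

definition alpha_index :: "nat \<Rightarrow> nat \<Rightarrow> int \<times> bool" where
  "alpha_index n k = (int (if k < n - 1 then k + 1 else k + 2), False)"

lemma bij_betw_center_index:
  assumes "n > 0"
  shows "bij_betw (center_index n) {..<2} {(0, False), (int n, False)}"
proof -
  have "{..<2 :: nat} = {0, 1}" by auto
  then show ?thesis using assms by (simp add: bij_betw_def center_index_def)
qed

lemma bij_betw_beta_index:
  assumes "n > 0"
  shows "bij_betw (beta_index n) ({..<n} \<times> {..<2}) ({0..<2 * int n} \<times> {True})"
\<comment> \<open>Division with remainder by n recovers the position in the copy and the number of
  the copy.\<close>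
proof (rule bij_betw_byWitness[where f' = "\<lambda>(i, c). (nat i mod n, nat i div n)"])
  show "beta_index n ` ({..<n} \<times> {..<2}) \<subseteq> {0..<2 * int n} \<times> {True}"
    by (auto simp: beta_index_def less_2_cases_iff)
  show "(\<lambda>(i, c). (nat i mod n, nat i div n)) ` ({0..<2 * int n} \<times> {True}) \<subseteq> {..<n} \<times> {..<2}"
    using assms by (auto simp: less_mult_imp_div_less)
  show "\<forall>p\<in>{..<n} \<times> {..<2}. (\<lambda>(i, c). (nat i mod n, nat i div n)) (beta_index n p) = p"
    using assms by (auto simp: beta_index_def nat_int simp del: of_nat_add of_nat_mult)
  show "\<forall>p\<in>{0..<2 * int n} \<times> {True}. beta_index n ((\<lambda>(i, c). (nat i mod n, nat i div n)) p) = p"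
    using assms by (auto simp: beta_index_def simp del: of_nat_add of_nat_mult)
qed

lemma bij_betw_alpha_index:
  assumes "n \<ge> 2"
  shows "bij_betw (alpha_index n) {..<2 * n - 2} (({0..<2 * int n} - {0, int n}) \<times> {False})"
  by (rule bij_betw_byWitness[where f' = "\<lambda>(i, c). if i < int n then nat i - 1 else nat i - 2"])
    (use assms in \<open>auto simp: alpha_index_def split: if_splits\<close>)

text \<open>Commuting means equal exponents modulo n. The position inside a copy contributes a
  multiple of n, and copy numbers below n are their own residues.\<close>

lemma beta_index_commute_iff:
  assumes "p \<in> {..<n} \<times> {..<2}" "q \<in> {..<n} \<times> {..<2}"
  shows "nf_commute n (beta_index n p) (beta_index n q) \<longleftrightarrow> fst p = fst q"
proof -
  have "nf_commute n (beta_index n p) (beta_index n q) \<longleftrightarrow>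
      int (fst p + snd p * n) mod int n = int (fst q + snd q * n) mod int n"
    unfolding beta_index_def nf_commute.simps mod_eq_dvd_iff ..
  also have "\<dots> \<longleftrightarrow> fst p = fst q"
    using assms by (auto simp flip: of_nat_mod simp del: of_nat_add of_nat_mult)
  finally show ?thesis .
qed

text \<open>The only multiples of n in the range of exponents are 0 and n, and both are skipped.
  Hence no edge joins these nodes to any \<alpha>^i \<beta>.\<close>

lemma not_dvd_alpha_index:
  assumes "n \<ge> 2" "k < 2 * n - 2"
  shows "\<not> int n dvd fst (alpha_index n k)"
proof -
  have "alpha_index n k \<in> ({0..<2 * int n} - {0, int n}) \<times> {False}"
    using bij_betw_alpha_index[OF assms(1)] assms(2) by (auto dest: bij_betwE)
  then show ?thesis by (auto simp: int_dvd_lt_double_iff)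
qed

lemma bij_betw_case_sum:
  assumes "bij_betw f A C" "bij_betw g B D" "C \<inter> D = {}"
  shows "bij_betw (case_sum f g) (A <+> B) (C \<union> D)"
  unfolding Plus_def
proof (rule bij_betw_combine[OF _ _ assms(3)])
  show "bij_betw (case_sum f g) (Inl ` A) C" "bij_betw (case_sum f g) (Inr ` B) D"
    using assms(1,2) by (simp_all add: bij_betw_def inj_on_def image_image)
qed

section \<open>The four graph isomorphisms\<close>

theorem proposition4p1:
  fixes n :: nat and \<Gamma> :: "bd_generator word set set"
  assumes "n \<ge> 2"
  shows
    "(\<Gamma> = group_center (BD n) \<longrightarrow>
        digraph_iso (with_proj (commuting_graph (BD n) \<Gamma>)) (with_proj (complete_graph 2))) \<and>
     (\<Gamma> = Gamma2 n \<longrightarrow>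
        digraph_iso (with_proj (commuting_graph (BD n) \<Gamma>))
          (with_proj (graph_copies n (complete_graph 2)))) \<and>
     (\<Gamma> = Gamma3 n \<longrightarrow>
        digraph_iso (with_proj (commuting_graph (BD n) \<Gamma>))
          (with_proj (complete_graph (2 * n - 2)))) \<and>
     (\<Gamma> = carrier (BD n) \<longrightarrow>
        digraph_iso (with_proj (commuting_graph (BD n) \<Gamma>))
          (with_proj (graph_join (complete_graph 2)
            (graph_disjoint_union (graph_copies n (complete_graph 2))
              (complete_graph (2 * n - 2))))))"
proof (intro conjI impI)
  have pos: "n > 0" using assms by simp
  let ?Z = "{(0, False), (int n, False)}"
  let ?B = "{0..<2 * int n} \<times> {True}"
  let ?A = "({0..<2 * int n} - {0, int n}) \<times> {False}"
  note K = pair_graph_complete_graph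
  note nK = pair_graph_graph_copies[OF K]
  show "digraph_iso (with_proj (commuting_graph (BD n) \<Gamma>)) (with_proj (complete_graph 2))"
    if "\<Gamma> = group_center (BD n)"
    unfolding that group_center_BD[OF assms]
    by (rule digraph_iso_commuting_graph_BD[OF pos K, where f = "center_index n"])
      (use pos bij_betw_center_index[OF pos] in
        \<open>auto simp: complete_graph_def center_index_def\<close>)
  show "digraph_iso (with_proj (commuting_graph (BD n) \<Gamma>))
      (with_proj (graph_copies n (complete_graph 2)))"
    if "\<Gamma> = Gamma2 n"
    unfolding that Gamma2_eq
    by (rule digraph_iso_commuting_graph_BD[OF pos nK, where f = "beta_index n"])
      (use pos bij_betw_beta_index[OF pos] in
        \<open>auto simp: graph_copies_def complete_graph_def beta_index_commute_iff\<close>)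
  show "digraph_iso (with_proj (commuting_graph (BD n) \<Gamma>))
      (with_proj (complete_graph (2 * n - 2)))"
    if "\<Gamma> = Gamma3 n"
    unfolding that Gamma3_eq[OF assms]
    by (rule digraph_iso_commuting_graph_BD[OF pos K, where f = "alpha_index n"])
      (use pos bij_betw_alpha_index[OF assms] in
        \<open>auto simp: complete_graph_def alpha_index_def\<close>)
  let ?H = "graph_join (complete_graph 2)
      (graph_disjoint_union (graph_copies n (complete_graph 2)) (complete_graph (2 * n - 2)))"
  let ?f = "case_sum (center_index n) (case_sum (beta_index n) (alpha_index n))"
  show "digraph_iso (with_proj (commuting_graph (BD n) \<Gamma>)) (with_proj ?H)"
    if "\<Gamma> = carrier (BD n)"
  proof -
    \<comment> \<open>The order of the three blocks follows the nesting of the sum types in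
      \<open>?H\<close>, so that \<open>bij_betw_case_sum\<close> glues the labellings.\<close>
    have split: "nf_carrier n = ?Z \<union> (?B \<union> ?A)" using pos by auto
    have \<Gamma>: "\<Gamma> = bd_elem n ` nf_carrier n"
      using that bij_betw_bd_elem[OF pos] by (simp add: bij_betw_def)
    show ?thesis
      unfolding \<Gamma>
    proof (rule digraph_iso_commuting_graph_BD[where f = ?f, OF pos])
      show "pair_graph ?H"
        by (intro pair_graph_graph_join pair_graph_graph_disjoint_union K nK)
    next
      have "bij_betw ?f ({..<2} <+> ({..<n} \<times> {..<2} <+> {..<2 * n - 2})) (?Z \<union> (?B \<union> ?A))"
        by (intro bij_betw_case_sum bij_betw_center_index bij_betw_beta_index bij_betw_alpha_index
            pos assms) auto
      then show "bij_betw ?f (pverts ?H) (nf_carrier n)"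
        unfolding split
        by (simp add: graph_join_def graph_disjoint_union_def graph_copies_def complete_graph_def)
    next
      fix x y assume xy: "x \<in> pverts ?H" "y \<in> pverts ?H" "x \<noteq> y"
      \<comment> \<open>Central elements commute with everything, which gives the join;
        \<open>beta_alpha\<close> below gives the absence of edges between the two parts of the
        disjoint union.\<close>
      have center: "nf_commute n (center_index n k) p" "nf_commute n p (center_index n k)" for k p
        by (cases p; cases "snd p"; simp add: center_index_def)+
      have alpha: "nf_commute n (alpha_index n k) (alpha_index n l)" for k l
        by (simp add: alpha_index_def)
      have beta_alpha: "\<not> nf_commute n (beta_index n p) (alpha_index n k)"
        "\<not> nf_commute n (alpha_index n k) (beta_index n p)" if "k < 2 * n - 2" for p k
        using not_dvd_alpha_index[OF assms that] by (simp_all add: beta_index_def alpha_index_def)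
      show "(x, y) \<in> parcs ?H \<longleftrightarrow> nf_commute n (?f x) (?f y)"
        using xy
        by (auto simp: graph_join_def graph_disjoint_union_def graph_copies_def complete_graph_def
            map_prod_sum_iff center alpha beta_alpha beta_index_commute_iff)
    qed simp
  qed
qed

end
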